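(* Let $X$ and $Y$ be Hausdorff locally convex topological vector spaces, $\varphi: X\times Y\to\overline{\mathbb{R}}$ a proper convex function, $g_i: X\times Y\to\mathbb{R}$, $i\in I:=\{1,\dots,m\}$, continuous convex functions, $C\subset X\times Y$ a convex set, and, for $j\in J:=\{1,\dots,k\}$, let $h_j(x,y)=\langle(x_j^*,y_j^* ),(x,y)\rangle-\alpha_j$ with $(x_j^*,y_j^* )\in X^*\times Y^*$ and $\alpha_j\in\mathbb{R}$. Let $\mu$ be the optimal value function and $M$ the solution map of the parametric problem $$\min\{\varphi(x,y)\mid (x,y)\in C,\ g_i(x,y)\le 0,\ i\in I,\ h_j(x,y)=0,\ j\in J\}$$ (minimization over $y\in Y$, with parameter $x\in X$). Suppose that $M(\bar x)$ is nonempty for some $\bar x\in{\rm dom}\,\mu$. If $\varphi$ is continuous at a point $(x^0,y^0)\in{\rm int}\,C$ with $g_i(x^0,y^0)<0$ for all $i\in I$ and $h_j(x^0,y^0)=0$ for all $j\in J$, then for any $\bar y\in M(\bar x)$ one has $$\partial\mu(\bar x)=\bigcup_{(\lambda,\nu)\in\Lambda_0(\bar x,\bar y)}{\rm pr}_{X^*}\Big(\partial L(\bar x,\bar y,\lambda,\nu)\cap\big(X^*\times\{0\}\big)\Big),$$ where $\partial L(\bar x,\bar y,\lambda,\nu)$ is the subdifferential of the function $L(\cdot,\cdot,\lambda,\nu)$ at $(\bar x,\bar y)$ and ${\rm pr}_{X^*}(x^*,y^* ):=x^*$ for $(x^*,y^* )\in X^*\times Y^*$.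
   Context: $\overline{\mathbb{R}}=[-\infty,+\infty]$; $X^*,Y^*$ are the topological duals, and $(X\times Y)^*$ is identified with $X^*\times Y^*$ via $\langle(x^*,y^* ),(x,y)\rangle=\langle x^*,x\rangle+\langle y^*,y\rangle$. A function $f: Z\to\overline{\mathbb{R}}$ is proper if $f>-\infty$ everywhere and ${\rm dom}\,f=\{z\mid f(z)<+\infty\}\neq\emptyset$; convex if its epigraph $\{(z,\alpha)\in Z\times\mathbb{R}\mid\alpha\ge f(z)\}$ is convex. "Continuous at a point" means finite-valued and continuous there. For $f$ convex and finite at $\bar z$, $\partial f(\bar z)=\{z^*\in Z^*\mid\langle z^*,z-\bar z\rangle\le f(z)-f(\bar z)\ \forall z\in Z\}$ (for $\bar z\notin{\rm dom}\,f$, $\partial f(\bar z)=\emptyset$). Let $G(x)=\{y\in Y\mid(x,y)\in C,\ g_i(x,y)\le 0\ \forall i\in I,\ h_j(x,y)=0\ \forall j\in J\}$. Then $\mu(x)=\inf\{\varphi(x,y)\mid y\in G(x)\}$ (with $\inf\emptyset=+\infty$), ${\rm dom}\,\mu=\{x\mid\mu(x)<+\infty\}$, and $M(x)=\{y\in G(x)\mid\mu(x)=\varphi(x,y)\}$. The Lagrangian is $$L(x,y,\lambda,\nu)=\varphi(x,y)+\sum_{i\in I}\lambda_i g_i(x,y)+\sum_{j\in J}\nu_j h_j(x,y)+\iota_C((x,y)),\quad \lambda\in\mathbb{R}^m,\ \nu\in\mathbb{R}^k,$$ where $\iota_C$ is the indicator function ($0$ on $C$, $+\infty$ off $C$). With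 $I(x,y)=\{i\in I\mid g_i(x,y)=0\}$, $\Lambda_0(x,y)$ is the set of all $(\lambda,\nu)\in\mathbb{R}^m\times\mathbb{R}^k$ with $\lambda_i\ge 0$ for all $i\in I$ and $\lambda_i=0$ for all $i\in I\setminus I(x,y)$. *)

theory Defs
  imports "HOL-Analysis.Analysis"
begin

text \<open>Real Hausdorff locally convex topological vector spaces. Convexity of \<open>V\<close> is written out because
  the constant \<open>convex\<close> cannot occur in a class specification; see the lemma below.\<close>

class real_lctvs = real_vector + topological_ab_group_add + t2_space +
  assumes tendsto_scaleR_nhds:
    "LIM p (nhds r \<times>\<^sub>F nhds x). fst p *\<^sub>R snd p :> nhds (r *\<^sub>R x)"
  assumes locally_convex:
    "open U \<Longrightarrow> 0 \<in> U \<Longrightarrow> \<exists>V. open V \<and> 0 \<in> V \<and> V \<subseteq> U \<and>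
       (\<forall>x\<in>V. \<forall>y\<in>V. \<forall>u\<ge>0. \<forall>v\<ge>0. u + v = 1 \<longrightarrow> u *\<^sub>R x + v *\<^sub>R y \<in> V)"

lemma locally_convex_nhds_0:
  fixes U :: "'z::real_lctvs set"
  assumes "open U" "0 \<in> U"
  shows "\<exists>V. open V \<and> 0 \<in> V \<and> convex V \<and> V \<subseteq> U"
  using locally_convex[OF assms] unfolding convex_def by blast

instance real_normed_vector \<subseteq> real_lctvs
proof
  show "LIM p (nhds r \<times>\<^sub>F nhds x). fst p *\<^sub>R snd p :> nhds (r *\<^sub>R x)" for r and x :: 'a
    by (intro tendsto_scaleR filterlim_fst filterlim_snd)
  show "\<exists>V. open V \<and> 0 \<in> V \<and> V \<subseteq> U \<and>
      (\<forall>x\<in>V. \<forall>y\<in>V. \<forall>u\<ge>0. \<forall>v\<ge>0. u + v = 1 \<longrightarrow> u *\<^sub>R x + v *\<^sub>R y \<in> V)"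
    if "open U" "0 \<in> U" for U :: "'a set"
    unfolding convex_def[symmetric]
    using that by (metis convex_ball centre_in_ball open_ball open_contains_ball)
qed

text \<open>Topological duals. Following the usual identification of the dual of a product, an element
  of \<open>(X \<times> Y)\<^sup>*\<close> is given by a pair of functionals acting through \<open>pair_functional\<close>.\<close>

definition dual_space :: "('z::{real_vector,topological_space} \<Rightarrow> real) set" where
  "dual_space = {f. linear f \<and> continuous_on UNIV f}"

definition pair_functional :: "('x \<Rightarrow> real) \<Rightarrow> ('y \<Rightarrow> real) \<Rightarrow> 'x \<times> 'y \<Rightarrow> real" where
  "pair_functional xs ys = (\<lambda>(x, y). xs x + ys y)"

definition eff_dom :: "('z \<Rightarrow> ereal) \<Rightarrow> 'z set" where
  "eff_dom f = {z. f z < \<infinity>}"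

definition proper_fun :: "('z \<Rightarrow> ereal) \<Rightarrow> bool" where
  "proper_fun f \<longleftrightarrow> (\<forall>z. f z > -\<infinity>) \<and> eff_dom f \<noteq> {}"

text \<open>The library notions \<open>epigraph\<close> and \<open>convex_on\<close> only cover real-valued functions.\<close>

definition ereal_epigraph :: "('z \<Rightarrow> ereal) \<Rightarrow> ('z \<times> real) set" where
  "ereal_epigraph f = {(z, a). f z \<le> ereal a}"

definition convex_fun :: "('z::real_vector \<Rightarrow> ereal) \<Rightarrow> bool" where
  "convex_fun f \<longleftrightarrow> convex (ereal_epigraph f)"

text \<open>The subdifferential is empty at points where \<open>f\<close> is not finite, so the difference below never
  takes the form \<open>\<infinity> - \<infinity>\<close>.\<close>

definition subdifferential ::
    "('z::{real_vector,topological_space} \<Rightarrow> ereal) \<Rightarrow> 'z \<Rightarrow> ('z \<Rightarrow> real) set" where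
  "subdifferential f zb =
     (if \<bar>f zb\<bar> = \<infinity> then {}
      else {zs \<in> dual_space. \<forall>z. ereal (zs (z - zb)) \<le> f z - f zb})"

definition subdifferential_pair ::
    "('x::{real_vector,topological_space} \<times> 'y::{real_vector,topological_space} \<Rightarrow> ereal)
     \<Rightarrow> 'x \<times> 'y \<Rightarrow> (('x \<Rightarrow> real) \<times> ('y \<Rightarrow> real)) set" where
  "subdifferential_pair f zb =
     {(xs, ys). xs \<in> dual_space \<and> ys \<in> dual_space \<and> pair_functional xs ys \<in> subdifferential f zb}"

definition indicator_fun :: "'z set \<Rightarrow> 'z \<Rightarrow> ereal" where
  "indicator_fun C z = (if z \<in> C then 0 else \<infinity>)"

text \<open>The constraints are indexed by \<open>{1..m}\<close> and \<open>{1..k}\<close>.\<close>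

definition feasible_map ::
    "('x \<times> 'y) set \<Rightarrow> nat \<Rightarrow> (nat \<Rightarrow> 'x \<times> 'y \<Rightarrow> real) \<Rightarrow> nat \<Rightarrow> (nat \<Rightarrow> 'x \<times> 'y \<Rightarrow> real)
     \<Rightarrow> 'x \<Rightarrow> 'y set" where
  "feasible_map C m g k h x =
     {y. (x, y) \<in> C \<and> (\<forall>i\<in>{1..m}. g i (x, y) \<le> 0) \<and> (\<forall>j\<in>{1..k}. h j (x, y) = 0)}"

text \<open>In \<^typ>\<open>ereal\<close> the infimum of the empty set is \<open>\<infinity>\<close>.\<close>

definition optimal_value :: "('x \<times> 'y \<Rightarrow> ereal) \<Rightarrow> ('x \<Rightarrow> 'y set) \<Rightarrow> 'x \<Rightarrow> ereal" where
  "optimal_value \<phi> G x = (INF y\<in>G x. \<phi> (x, y))"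

definition solution_map :: "('x \<times> 'y \<Rightarrow> ereal) \<Rightarrow> ('x \<Rightarrow> 'y set) \<Rightarrow> 'x \<Rightarrow> 'y set" where
  "solution_map \<phi> G x = {y \<in> G x. optimal_value \<phi> G x = \<phi> (x, y)}"

definition Lagrangian ::
    "('z \<Rightarrow> ereal) \<Rightarrow> 'z set \<Rightarrow> nat \<Rightarrow> (nat \<Rightarrow> 'z \<Rightarrow> real) \<Rightarrow> nat \<Rightarrow> (nat \<Rightarrow> 'z \<Rightarrow> real)
     \<Rightarrow> (nat \<Rightarrow> real) \<Rightarrow> (nat \<Rightarrow> real) \<Rightarrow> 'z \<Rightarrow> ereal" where
  "Lagrangian \<phi> C m g k h l n z =
     \<phi> z + ereal (\<Sum>i=1..m. l i * g i z) + ereal (\<Sum>j=1..k. n j * h j z) + indicator_fun C z"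

definition active_set :: "nat \<Rightarrow> (nat \<Rightarrow> 'z \<Rightarrow> real) \<Rightarrow> 'z \<Rightarrow> nat set" where
  "active_set m g z = {i \<in> {1..m}. g i z = 0}"

text \<open>Vectors of \<open>\<real>\<^sup>m\<close> are extensional functions on \<open>{1..m}\<close>, which also covers \<open>m = 0\<close>.\<close>

definition multipliers ::
    "nat \<Rightarrow> (nat \<Rightarrow> 'z \<Rightarrow> real) \<Rightarrow> nat \<Rightarrow> 'z \<Rightarrow> ((nat \<Rightarrow> real) \<times> (nat \<Rightarrow> real)) set" where
  "multipliers m g k z =
     {(l, n). l \<in> {1..m} \<rightarrow>\<^sub>E UNIV \<and> n \<in> {1..k} \<rightarrow>\<^sub>E UNIV
        \<and> (\<forall>i\<in>{1..m}. l i \<ge> 0) \<and> (\<forall>i\<in>{1..m} - active_set m g z. l i = 0)}"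

end

theory Submission
  imports Defs
begin

text \<open>
  A continuous linear functional \<open>x\<^sup>*\<close> is a subgradient of \<open>\<mu>\<close> at \<open>xb\<close> exactly when \<open>(xb, yb)\<close>
  minimizes \<open>(x, y) \<mapsto> \<phi> (x, y) - x\<^sup>* x\<close> over all points satisfying the constraints, with \<open>x\<close> and \<open>y\<close>
  both free. The formula therefore says that this single convex program has Lagrange multipliers.
  One inclusion is weak duality: the Lagrangian is at most \<open>\<phi>\<close> at feasible points, and equal to \<open>\<phi>\<close>
  at \<open>(xb, yb)\<close> because multipliers of inactive constraints vanish.

  For the other inclusion, the finitely many scalar constraints are moved into the objective one at
  a time. Suppose that a convex \<open>f\<close> is nonnegative on \<open>{z \<in> D. g z \<le> 0}\<close> with \<open>g\<close> convex, or on
  \<open>{z \<in> D. g z = 0}\<close> with \<open>g\<close> affine, and that \<open>g\<close> takes both signs on \<open>D\<close>. A number \<open>l\<close> satisfies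
  \<open>f + l * g \<ge> 0\<close> on \<open>D\<close> when it lies above all quotients \<open>- f z / g z\<close> with \<open>g z > 0\<close> and below all
  quotients \<open>f w / (- g w)\<close> with \<open>g w < 0\<close>. Each lower bound is at most each upper bound, since the
  segment from \<open>z\<close> to \<open>w\<close> contains a feasible point, where \<open>f\<close> is nonnegative
  (\<open>sign_change_multiplier\<close>, \<open>convex_on_crossing_point\<close>). Thus the existence of each multiplier
  reduces to the completeness of the real line.

  The Slater point provides negative values of an inequality constraint. For an equality
  constraint it lies in the algebraic interior of the domain, so that an affine constraint which is
  not identically zero there takes both signs. This property is inherited by the intersection of
  the domain with the other equality constraints, even if the constraints are linearly dependent
  (\<open>equality_multipliers\<close>). That the Slater point is interior to the domain of \<open>\<phi>\<close> is what the
  continuity of \<open>\<phi>\<close> there yields.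
\<close>

section \<open>Lagrange multipliers for finitely many convex constraints\<close>

text \<open>The cross inequality compares the slopes \<open>- f z / g z\<close> and \<open>f w / (- g w)\<close>, multiplied out;
  any number between the two families of slopes is a multiplier.\<close>

lemma sign_change_multiplier:
  fixes f g :: "'a \<Rightarrow> real"
  assumes cross: "\<And>z w. z \<in> D \<Longrightarrow> w \<in> D \<Longrightarrow> g z > 0 \<Longrightarrow> g w < 0 \<Longrightarrow> 0 \<le> f z * (- g w) + f w * g z"
    and zero: "\<And>z. z \<in> D \<Longrightarrow> g z = 0 \<Longrightarrow> 0 \<le> f z"
    and pos: "\<exists>z\<in>D. g z > 0" and neg: "\<exists>w\<in>D. g w < 0"
  shows "\<exists>l. \<forall>z\<in>D. 0 \<le> f z + l * g z"
proof -
  define A where "A = (\<lambda>z. - f z / g z) ` {z\<in>D. g z > 0}"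
  have le: "a \<le> f w / (- g w)" if a: "a \<in> A" and w: "w \<in> D" "g w < 0" for a w
  proof -
    obtain z where z: "z \<in> D" "g z > 0" "a = - f z / g z" using a by (auto simp: A_def)
    show ?thesis using cross[OF z(1) w(1) z(2) w(2)] z(2) w(2) unfolding z(3)
      by (simp add: field_simps)
  qed
  have ne: "A \<noteq> {}" using pos by (auto simp: A_def)
  have bdd: "bdd_above A" using neg le by (auto simp: bdd_above_def)
  have "0 \<le> f z + Sup A * g z" if z: "z \<in> D" for z
  proof (cases "g z" "0::real" rule: linorder_cases)
    case less
    have "Sup A \<le> f z / (- g z)" by (rule cSup_least[OF ne]) (use le z less in auto)
    then show ?thesis using less by (simp add: field_simps)
  next
    case equal then show ?thesis using zero[OF z] by simp
  next
    case greater
    have "- f z / g z \<le> Sup A" by (rule cSup_upper[OF _ bdd]) (use z greater in \<open>auto simp: A_def\<close>)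
    then show ?thesis using greater by (simp add: field_simps)
  qed
  then show ?thesis by blast
qed

lemma convex_onD_mem:
  "convex_on D f \<Longrightarrow> z \<in> D \<Longrightarrow> w \<in> D \<Longrightarrow> u \<ge> 0 \<Longrightarrow> v \<ge> 0 \<Longrightarrow> u + v = 1 \<Longrightarrow> u *\<^sub>R z + v *\<^sub>R w \<in> D"
  by (rule convexD[OF convex_on_imp_convex])

lemma convex_onD_le:
  "convex_on D f \<Longrightarrow> z \<in> D \<Longrightarrow> w \<in> D \<Longrightarrow> u \<ge> 0 \<Longrightarrow> v \<ge> 0 \<Longrightarrow> u + v = 1 \<Longrightarrow>
    f (u *\<^sub>R z + v *\<^sub>R w) \<le> u * f z + v * f w"
  by (simp add: convex_on_def)

text \<open>The weights are those at which the chord of \<open>g\<close> vanishes. The point of the segment that they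
  define is feasible both for \<open>g \<le> 0\<close> with \<open>g\<close> convex and for \<open>g = 0\<close> with \<open>g\<close> affine, and the
  convexity of \<open>f\<close> turns \<open>f \<ge> 0\<close> there into the cross inequality of \<open>sign_change_multiplier\<close>.\<close>

lemma convex_on_crossing_point:
  fixes f g :: "'a::real_vector \<Rightarrow> real"
  assumes f: "convex_on D f" and zw: "z \<in> D" "w \<in> D" "g z > 0" "g w < 0"
  obtains u v where "u \<ge> 0" "v \<ge> 0" "u + v = 1" "u * g z + v * g w = 0"
    "0 \<le> f (u *\<^sub>R z + v *\<^sub>R w) \<Longrightarrow> 0 \<le> f z * (- g w) + f w * g z"
proof -
  define s where "s = g z - g w"
  define u v where "u = - g w / s" and "v = g z / s"
  have s: "s > 0" using zw by (simp add: s_def)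
  have uv: "u \<ge> 0" "v \<ge> 0" "u + v = 1" "u * g z + v * g w = 0"
  proof -
    show "u \<ge> 0" "v \<ge> 0" using s zw by (simp_all add: u_def v_def divide_nonpos_pos)
    have "u + v = (- g w + g z) / s" unfolding u_def v_def by (rule add_divide_distrib[symmetric])
    then show "u + v = 1" using s by (simp add: s_def)
    show "u * g z + v * g w = 0" by (simp add: u_def v_def)
  qed
  have "0 \<le> f z * (- g w) + f w * g z" if "0 \<le> f (u *\<^sub>R z + v *\<^sub>R w)"
  proof -
    have "f (u *\<^sub>R z + v *\<^sub>R w) \<le> u * f z + v * f w"
      by (rule convex_onD_le[OF f zw(1,2) uv(1-3)])
    then have "0 \<le> (u * f z + v * f w) * s" using that s by simp
    also have "\<dots> = f z * (- g w) + f w * g z" using s by (simp add: u_def v_def field_simps)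
    finally show ?thesis .
  qed
  with uv show ?thesis by (rule that)
qed

lemma inequality_multiplier:
  fixes f g :: "'a::real_vector \<Rightarrow> real"
  assumes f: "convex_on D f" and g: "convex_on D g"
    and slater: "z0 \<in> D" "g z0 < 0"
    and nonneg: "\<And>z. z \<in> D \<Longrightarrow> g z \<le> 0 \<Longrightarrow> 0 \<le> f z"
  shows "\<exists>l\<ge>0. \<forall>z\<in>D. 0 \<le> f z + l * g z"
proof (cases "\<exists>z\<in>D. g z > 0")
  case False
  then show ?thesis using nonneg by (intro exI[of _ 0]) force
next
  case True
  have "\<exists>l. \<forall>z\<in>D. 0 \<le> f z + l * g z"
  proof (rule sign_change_multiplier[OF _ _ True])
    fix z w assume zw: "z \<in> D" "w \<in> D" "g z > 0" "g w < 0"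
    obtain u v where uv: "u \<ge> 0" "v \<ge> 0" "u + v = 1" "u * g z + v * g w = 0"
      "0 \<le> f (u *\<^sub>R z + v *\<^sub>R w) \<Longrightarrow> 0 \<le> f z * (- g w) + f w * g z"
      using convex_on_crossing_point[OF f zw] by blast
    have "u *\<^sub>R z + v *\<^sub>R w \<in> D" "g (u *\<^sub>R z + v *\<^sub>R w) \<le> u * g z + v * g w"
      using convex_onD_mem[OF g zw(1,2) uv(1-3)] convex_onD_le[OF g zw(1,2) uv(1-3)] .
    then show "0 \<le> f z * (- g w) + f w * g z" using nonneg uv by simp
  qed (use nonneg slater in auto)
  then obtain l where l: "\<And>z. z \<in> D \<Longrightarrow> 0 \<le> f z + l * g z" by blast
  \<comment> \<open>A negative multiplier may be replaced by zero: it forces \<open>f \<ge> 0\<close> where \<open>g > 0\<close>.\<close>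
  have "0 \<le> f z + max l 0 * g z" if "z \<in> D" for z
  proof (cases "l \<ge> 0 \<or> g z \<le> 0")
    case True
    then show ?thesis using l[OF that] nonneg[OF that] by (auto simp: max_def)
  next
    case False
    then have "l * g z \<le> 0" by (simp add: mult_nonpos_nonneg)
    then show ?thesis using False l[OF that] by (simp add: max_def)
  qed
  then show ?thesis by (intro exI[of _ "max l 0"]) auto
qed

lemma convex_on_sublevel:
  fixes f :: "'a::real_vector \<Rightarrow> real"
  assumes "convex_on D f"
  shows "convex {z\<in>D. f z \<le> c}"
  unfolding convex_def
proof (clarify, intro conjI)
  fix z w u v assume z: "z \<in> D" "f z \<le> c" and w: "w \<in> D" "f w \<le> c"
    and uv: "(u::real) \<ge> 0" "v \<ge> 0" "u + v = 1"
  show "u *\<^sub>R z + v *\<^sub>R w \<in> D"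
    by (rule convex_onD_mem[OF assms z(1) w(1) uv])
  have "f (u *\<^sub>R z + v *\<^sub>R w) \<le> u * f z + v * f w"
    by (rule convex_onD_le[OF assms z(1) w(1) uv])
  also have "\<dots> \<le> u * c + v * c" using z w uv by (intro add_mono mult_left_mono)
  also have "\<dots> = c" using uv by (simp flip: distrib_right)
  finally show "f (u *\<^sub>R z + v *\<^sub>R w) \<le> c" .
qed

text \<open>Each constraint is eliminated on the set where the remaining ones hold. The Slater condition
  passes to that set, and \<open>f + a * g i\<close> is a convex objective for the remaining constraints.\<close>

lemma inequality_multipliers:
  fixes f :: "'a::real_vector \<Rightarrow> real" and g :: "'i \<Rightarrow> 'a \<Rightarrow> real"
  assumes "finite I" and "convex_on D f" and "\<And>i. i \<in> I \<Longrightarrow> convex_on D (g i)"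
    and "z0 \<in> D" and "\<And>i. i \<in> I \<Longrightarrow> g i z0 < 0"
    and "\<And>z. z \<in> D \<Longrightarrow> \<forall>i\<in>I. g i z \<le> 0 \<Longrightarrow> 0 \<le> f z"
  shows "\<exists>l. (\<forall>i\<in>I. l i \<ge> 0) \<and> (\<forall>z\<in>D. 0 \<le> f z + (\<Sum>i\<in>I. l i * g i z))"
  using assms
proof (induction I arbitrary: f)
  case empty
  then show ?case by simp
next
  case (insert i I)
  define E where "E = {z\<in>D. \<forall>j\<in>I. g j z \<le> 0}"
  have cD: "convex D" using insert.prems(1) by (simp add: convex_on_def)
  have "convex {z\<in>D. g j z \<le> 0}" if "j \<in> I" for j
    by (rule convex_on_sublevel) (rule insert.prems(2), use that in simp)
  moreover have "E = D \<inter> (\<Inter>j\<in>I. {z\<in>D. g j z \<le> 0})" by (auto simp: E_def)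
  ultimately have cE: "convex E" using cD by (auto intro!: convex_Int convex_INT)
  have sub: "E \<subseteq> D" by (auto simp: E_def)
  have "\<exists>a\<ge>0. \<forall>z\<in>E. 0 \<le> f z + a * g i z"
  proof (rule inequality_multiplier)
    show "convex_on E f" "convex_on E (g i)"
      using insert.prems sub cE by (auto intro: convex_on_subset)
    show "z0 \<in> E" "g i z0 < 0"
      using insert.prems(3,4) by (auto simp: E_def less_imp_le)
  qed (use insert.prems in \<open>auto simp: E_def\<close>)
  then obtain a where a: "a \<ge> 0" "\<And>z. z \<in> E \<Longrightarrow> 0 \<le> f z + a * g i z" by blast
  have "\<exists>l. (\<forall>j\<in>I. l j \<ge> 0) \<and> (\<forall>z\<in>D. 0 \<le> (f z + a * g i z) + (\<Sum>j\<in>I. l j * g j z))"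
  proof (rule insert.IH)
    show "convex_on D (\<lambda>z. f z + a * g i z)"
      using insert.prems a by (intro convex_on_add convex_on_cmul) auto
  qed (use insert.prems a in \<open>auto simp: E_def\<close>)
  then obtain l where l: "\<forall>j\<in>I. l j \<ge> 0"
    "\<And>z. z \<in> D \<Longrightarrow> 0 \<le> (f z + a * g i z) + (\<Sum>j\<in>I. l j * g j z)" by blast
  have "(\<Sum>j\<in>insert i I. (l(i:=a)) j * g j z) = a * g i z + (\<Sum>j\<in>I. l j * g j z)" for z
    using insert.hyps by (simp, intro sum.cong) auto
  then show ?case using l a by (intro exI[of _ "l(i:=a)"]) (auto simp: add.assoc)
qed

text \<open>The hypothesis \<open>core\<close> says that \<open>D\<close> extends beyond \<open>z0\<close> on every segment ending there, so an
  affine \<open>h\<close> that vanishes at \<open>z0\<close> and is nonzero somewhere takes both signs. If \<open>h\<close> vanishes on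
  \<open>D\<close>, any multiplier will do.\<close>

lemma equality_multiplier:
  fixes f h :: "'a::real_vector \<Rightarrow> real"
  assumes f: "convex_on D f"
    and affine: "\<And>u v z w. u + v = 1 \<Longrightarrow> h (u *\<^sub>R z + v *\<^sub>R w) = u * h z + v * h w"
    and z0: "h z0 = 0"
    and core: "\<And>z. z \<in> D \<Longrightarrow> \<exists>t>0. (1 + t) *\<^sub>R z0 + (- t) *\<^sub>R z \<in> D"
    and nonneg: "\<And>z. z \<in> D \<Longrightarrow> h z = 0 \<Longrightarrow> 0 \<le> f z"
  shows "\<exists>n. \<forall>z\<in>D. 0 \<le> f z + n * h z"
proof (cases "\<forall>z\<in>D. h z = 0")
  case True
  then show ?thesis using nonneg by auto
next
  case False
  have opposite: "\<exists>w\<in>D. \<exists>t>0. h w = - t * h z" if z: "z \<in> D" for z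
  proof -
    obtain t where t: "t > 0" "(1 + t) *\<^sub>R z0 + (- t) *\<^sub>R z \<in> D" using core[OF z] by blast
    have "h ((1 + t) *\<^sub>R z0 + (- t) *\<^sub>R z) = - t * h z" by (subst affine) (auto simp: z0)
    with t show ?thesis by blast
  qed
  obtain z where z: "z \<in> D" "h z \<noteq> 0" using False by blast
  obtain w t where w: "w \<in> D" "t > 0" "h w = - t * h z" using opposite[OF z(1)] by blast
  have "h z > 0 \<and> h w < 0 \<or> h z < 0 \<and> h w > 0"
    using z(2) w(2) by (auto simp: w(3) linorder_neq_iff mult_neg_pos mult_pos_neg mult_less_0_iff)
  then have signs: "\<exists>z\<in>D. h z > 0" "\<exists>w\<in>D. h w < 0"
    using z(1) w(1) by blast+
  show ?thesis
  proof (rule sign_change_multiplier[OF _ _ signs])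
    fix z w assume zw: "z \<in> D" "w \<in> D" "h z > 0" "h w < 0"
    obtain u v where uv: "u \<ge> 0" "v \<ge> 0" "u + v = 1" "u * h z + v * h w = 0"
      "0 \<le> f (u *\<^sub>R z + v *\<^sub>R w) \<Longrightarrow> 0 \<le> f z * (- h w) + f w * h z"
      using convex_on_crossing_point[OF f zw] by blast
    have "u *\<^sub>R z + v *\<^sub>R w \<in> D"
      by (rule convex_onD_mem[OF f zw(1,2) uv(1-3)])
    then show "0 \<le> f z * (- h w) + f w * h z" using nonneg uv affine[OF uv(3)] by simp
  qed (use nonneg in auto)
qed

text \<open>The hypothesis \<open>core\<close> of \<open>equality_multiplier\<close> holds on the set where the remaining constraints
  vanish, because affine functions vanishing at \<open>z0\<close> and \<open>z\<close> vanish on the line through them.\<close>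

lemma equality_multipliers:
  fixes f :: "'a::real_vector \<Rightarrow> real" and h :: "'j \<Rightarrow> 'a \<Rightarrow> real"
  assumes "finite J" and "convex_on D f"
    and "\<And>j u v z w. j \<in> J \<Longrightarrow> u + v = 1 \<Longrightarrow> h j (u *\<^sub>R z + v *\<^sub>R w) = u * h j z + v * h j w"
    and "\<And>j. j \<in> J \<Longrightarrow> h j z0 = 0"
    and "\<And>z. z \<in> D \<Longrightarrow> \<exists>t>0. (1 + t) *\<^sub>R z0 + (- t) *\<^sub>R z \<in> D"
    and "\<And>z. z \<in> D \<Longrightarrow> \<forall>j\<in>J. h j z = 0 \<Longrightarrow> 0 \<le> f z"
  shows "\<exists>n. \<forall>z\<in>D. 0 \<le> f z + (\<Sum>j\<in>J. n j * h j z)"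
  using assms
proof (induction J arbitrary: f)
  case empty
  then show ?case by simp
next
  case (insert i J)
  define E where "E = {z\<in>D. \<forall>j\<in>J. h j z = 0}"
  have "convex D" using insert.prems(1) by (simp add: convex_on_def)
  then have cE: "convex E" unfolding E_def convex_def by (auto simp: insert.prems(2))
  have "\<exists>a. \<forall>z\<in>E. 0 \<le> f z + a * h i z"
  proof (rule equality_multiplier)
    show "convex_on E f"
      by (rule convex_on_subset[OF insert.prems(1) _ cE]) (auto simp: E_def)
    show "\<exists>t>0. (1 + t) *\<^sub>R z0 + (- t) *\<^sub>R z \<in> E" if z: "z \<in> E" for z
    proof -
      obtain t where t: "t > 0" "(1 + t) *\<^sub>R z0 + (- t) *\<^sub>R z \<in> D"
        using insert.prems(4) z by (auto simp: E_def)
      have "h j ((1 + t) *\<^sub>R z0 + (- t) *\<^sub>R z) = 0" if "j \<in> J" for j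
        by (subst insert.prems(2)) (use that z insert.prems(3) in \<open>auto simp: E_def\<close>)
      then show ?thesis using t by (auto simp: E_def)
    qed
  qed (use insert.prems in \<open>auto simp: E_def\<close>)
  then obtain a where a: "\<And>z. z \<in> E \<Longrightarrow> 0 \<le> f z + a * h i z" by blast
  have "convex_on D (\<lambda>z. a * h i z)"
    using \<open>convex D\<close> by (auto simp: convex_on_def insert.prems(2) algebra_simps)
  then have "convex_on D (\<lambda>z. f z + a * h i z)"
    using insert.prems(1) by (intro convex_on_add)
  then have "\<exists>n. \<forall>z\<in>D. 0 \<le> (f z + a * h i z) + (\<Sum>j\<in>J. n j * h j z)"
    by (rule insert.IH) (use insert.prems a in \<open>auto simp: E_def\<close>)
  then obtain n where n: "\<And>z. z \<in> D \<Longrightarrow> 0 \<le> (f z + a * h i z) + (\<Sum>j\<in>J. n j * h j z)"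
    by blast
  have "(\<Sum>j\<in>insert i J. (n(i:=a)) j * h j z) = a * h i z + (\<Sum>j\<in>J. n j * h j z)" for z
    using insert.hyps by (simp, intro sum.cong) auto
  then show ?case using n by (intro exI[of _ "n(i:=a)"]) (auto simp: add.assoc)
qed

text \<open>The inequalities go first, on the convex set cut out by the equalities: this set contains the
  Slater point, and the sum of \<open>f\<close> and the nonnegatively weighted inequality constraints is again a
  convex objective on \<open>D\<close>, to which the elimination of the equalities applies.\<close>

theorem convex_program_multipliers:
  fixes f :: "'a::real_vector \<Rightarrow> real" and g :: "'i \<Rightarrow> 'a \<Rightarrow> real" and h :: "'j \<Rightarrow> 'a \<Rightarrow> real"
  assumes "finite I" and "finite J" and f: "convex_on D f"
    and g: "\<And>i. i \<in> I \<Longrightarrow> convex_on D (g i)"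
    and h: "\<And>j u v z w. j \<in> J \<Longrightarrow> u + v = 1 \<Longrightarrow> h j (u *\<^sub>R z + v *\<^sub>R w) = u * h j z + v * h j w"
    and z0: "z0 \<in> D" "\<And>i. i \<in> I \<Longrightarrow> g i z0 < 0" "\<And>j. j \<in> J \<Longrightarrow> h j z0 = 0"
    and core: "\<And>z. z \<in> D \<Longrightarrow> \<exists>t>0. (1 + t) *\<^sub>R z0 + (- t) *\<^sub>R z \<in> D"
    and nonneg: "\<And>z. z \<in> D \<Longrightarrow> \<forall>i\<in>I. g i z \<le> 0 \<Longrightarrow> \<forall>j\<in>J. h j z = 0 \<Longrightarrow> 0 \<le> f z"
  obtains l n where "\<And>i. i \<in> I \<Longrightarrow> l i \<ge> 0"
    and "\<And>z. z \<in> D \<Longrightarrow> 0 \<le> f z + (\<Sum>i\<in>I. l i * g i z) + (\<Sum>j\<in>J. n j * h j z)"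
proof -
  define E where "E = {z\<in>D. \<forall>j\<in>J. h j z = 0}"
  have "convex D" using f by (simp add: convex_on_def)
  then have cE: "convex E" unfolding E_def convex_def by (auto simp: h)
  have sub: "E \<subseteq> D" by (auto simp: E_def)
  have "\<exists>l. (\<forall>i\<in>I. l i \<ge> 0) \<and> (\<forall>z\<in>E. 0 \<le> f z + (\<Sum>i\<in>I. l i * g i z))"
    by (rule inequality_multipliers[where ?z0.0 = z0])
       (use assms convex_on_subset[OF _ sub cE] in \<open>auto simp: E_def\<close>)
  then obtain l where l: "\<forall>i\<in>I. l i \<ge> 0"
    "\<And>z. z \<in> E \<Longrightarrow> 0 \<le> f z + (\<Sum>i\<in>I. l i * g i z)" by blast
  have "convex_on D (\<lambda>z. \<Sum>i\<in>I. l i * g i z)"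
    using \<open>finite I\<close> g l(1)
  proof (induction I)
    case empty
    then show ?case using \<open>convex D\<close> by (simp add: convex_on_def)
  qed (auto intro!: convex_on_add convex_on_cmul)
  then have "convex_on D (\<lambda>z. f z + (\<Sum>i\<in>I. l i * g i z))"
    using f by (intro convex_on_add)
  then have "\<exists>n. \<forall>z\<in>D. 0 \<le> (f z + (\<Sum>i\<in>I. l i * g i z)) + (\<Sum>j\<in>J. n j * h j z)"
    by (rule equality_multipliers[OF \<open>finite J\<close>, where ?z0.0 = z0])
       (use assms l in \<open>auto simp: E_def\<close>)
  then show ?thesis using l(1) that by blast
qed

section \<open>Extended-real convex functions and functionals on a product\<close>

lemma convex_fun_imp_convex_on_eff_dom:
  fixes \<phi> :: "'z::real_vector \<Rightarrow> ereal"
  assumes "proper_fun \<phi>" and "convex_fun \<phi>"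
  shows "convex_on (eff_dom \<phi>) (\<lambda>z. real_of_ereal (\<phi> z))"
proof -
  have fin: "\<phi> z = ereal (real_of_ereal (\<phi> z))" if "z \<in> eff_dom \<phi>" for z
    using assms(1)[unfolded proper_fun_def, THEN conjunct1, rule_format, of z] that
    by (cases "\<phi> z") (auto simp: eff_dom_def)
  have *: "\<phi> (u *\<^sub>R z + v *\<^sub>R w) \<le> ereal (u * real_of_ereal (\<phi> z) + v * real_of_ereal (\<phi> w))"
    if zw: "z \<in> eff_dom \<phi>" "w \<in> eff_dom \<phi>" and uv: "u \<ge> 0" "v \<ge> 0" "u + v = 1" for z w u v
  proof -
    have "(z, real_of_ereal (\<phi> z)) \<in> ereal_epigraph \<phi>" "(w, real_of_ereal (\<phi> w)) \<in> ereal_epigraph \<phi>"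
      using fin zw by (simp_all add: ereal_epigraph_def flip: fin)
    then have "u *\<^sub>R (z, real_of_ereal (\<phi> z)) + v *\<^sub>R (w, real_of_ereal (\<phi> w)) \<in> ereal_epigraph \<phi>"
      using assms(2) uv unfolding convex_fun_def convex_def by blast
    then show ?thesis by (simp add: ereal_epigraph_def)
  qed
  have dom: "u *\<^sub>R z + v *\<^sub>R w \<in> eff_dom \<phi>"
    if "z \<in> eff_dom \<phi>" "w \<in> eff_dom \<phi>" "u \<ge> 0" "v \<ge> 0" "u + v = 1" for z w u v
    using *[OF that] unfolding eff_dom_def by (auto intro: le_less_trans)
  show ?thesis
    unfolding convex_on_def convex_def
  proof (intro conjI ballI allI impI)
    fix z w u v assume a: "z \<in> eff_dom \<phi>" "w \<in> eff_dom \<phi>" "(u::real) \<ge> 0" "v \<ge> 0" "u + v = 1"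
    show "u *\<^sub>R z + v *\<^sub>R w \<in> eff_dom \<phi>" by (rule dom[OF a])
    show "real_of_ereal (\<phi> (u *\<^sub>R z + v *\<^sub>R w)) \<le> u * real_of_ereal (\<phi> z) + v * real_of_ereal (\<phi> w)"
      using *[OF a] fin[OF dom[OF a]] by (metis ereal_less_eq(3))
  qed
qed

lemma real_lctvs_tendsto_scaleR:
  fixes x :: "'z::real_lctvs"
  assumes "(c \<longlongrightarrow> r) F"
  shows "((\<lambda>t. c t *\<^sub>R x) \<longlongrightarrow> r *\<^sub>R x) F"
  using filterlim_compose[OF tendsto_scaleR_nhds filterlim_Pair[OF assms tendsto_const]]
  by simp

text \<open>Continuity of the linear structure moves \<open>z0\<close> only slightly for small \<open>t\<close>. Applied to membership
  in a set with \<open>z0\<close> in its interior, this is the hypothesis \<open>core\<close> of \<open>convex_program_multipliers\<close>.\<close>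

lemma eventually_beyond_interior_point:
  fixes z0 z :: "'x::real_lctvs \<times> 'y::real_lctvs"
  assumes "\<forall>\<^sub>F w in nhds z0. P w"
  shows "\<exists>t>0. P ((1 + t) *\<^sub>R z0 + (- t) *\<^sub>R z)"
proof -
  have t: "((\<lambda>t::real. 1 + t) \<longlongrightarrow> 1) (at_right 0)" "((\<lambda>t::real. - t) \<longlongrightarrow> 0) (at_right 0)"
    by (auto intro!: tendsto_eq_intros)
  have "((\<lambda>t. (1 + t) *\<^sub>R a + (- t) *\<^sub>R b) \<longlongrightarrow> 1 *\<^sub>R a + 0 *\<^sub>R b) (at_right 0)" for a b :: 'x
    by (intro tendsto_add real_lctvs_tendsto_scaleR t)
  moreover have "((\<lambda>t. (1 + t) *\<^sub>R a + (- t) *\<^sub>R b) \<longlongrightarrow> 1 *\<^sub>R a + 0 *\<^sub>R b) (at_right 0)" for a b :: 'y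
    by (intro tendsto_add real_lctvs_tendsto_scaleR t)
  ultimately have "((\<lambda>t. ((1 + t) *\<^sub>R fst z0 + (- t) *\<^sub>R fst z, (1 + t) *\<^sub>R snd z0 + (- t) *\<^sub>R snd z))
      \<longlongrightarrow> (1 *\<^sub>R fst z0 + 0 *\<^sub>R fst z, 1 *\<^sub>R snd z0 + 0 *\<^sub>R snd z)) (at_right 0)"
    by (intro tendsto_Pair)
  then have "((\<lambda>t. (1 + t) *\<^sub>R z0 + (- t) *\<^sub>R z) \<longlongrightarrow> z0) (at_right 0)"
    by (simp add: prod_eq_iff scaleR_prod_def plus_prod_def)
  then have "\<forall>\<^sub>F t in at_right 0. P ((1 + t) *\<^sub>R z0 + (- t) *\<^sub>R z)"
    using assms by (simp add: filterlim_iff)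
  then obtain b where "b > 0" "\<And>t. 0 < t \<Longrightarrow> t < b \<Longrightarrow> P ((1 + t) *\<^sub>R z0 + (- t) *\<^sub>R z)"
    unfolding eventually_at_right_field by blast
  then show ?thesis by (intro exI[of _ "b / 2"]) auto
qed

lemma linear_pair_functional:
  assumes "linear xs" and "linear ys"
  shows "linear (pair_functional xs ys)"
  using assms unfolding pair_functional_def
  by (auto intro!: linearI simp: linear_add linear_scale algebra_simps)

lemma pair_functional_zero_in_dual_space:
  assumes "xs \<in> dual_space"
  shows "pair_functional xs (\<lambda>_. 0) \<in> dual_space"
proof -
  have "linear (pair_functional xs (\<lambda>_. 0))"
    by (rule linear_pair_functional) (use assms in \<open>simp_all add: dual_space_def linear_zero\<close>)
  moreover have "continuous_on UNIV (\<lambda>z. xs (fst z))"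
    by (rule continuous_on_compose2[of UNIV xs])
      (use assms in \<open>auto simp: dual_space_def intro: continuous_on_fst\<close>)
  ultimately show ?thesis by (simp add: dual_space_def pair_functional_def case_prod_beta')
qed

section \<open>The subdifferential of the optimal value function\<close>

theorem theorem8:
  fixes \<phi> :: "'x::real_lctvs \<times> 'y::real_lctvs \<Rightarrow> ereal"
    and C :: "('x \<times> 'y) set"
    and m k :: nat
    and g h :: "nat \<Rightarrow> 'x \<times> 'y \<Rightarrow> real"
    and xs :: "nat \<Rightarrow> 'x \<Rightarrow> real" and ys :: "nat \<Rightarrow> 'y \<Rightarrow> real" and \<alpha> :: "nat \<Rightarrow> real"
    and \<mu> :: "'x \<Rightarrow> ereal" and M :: "'x \<Rightarrow> 'y set"
    and xb x0 :: 'x and yb y0 :: 'y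
  assumes "proper_fun \<phi>" and "convex_fun \<phi>"
    and "\<And>i. i \<in> {1..m} \<Longrightarrow> continuous_on UNIV (g i)"
    and "\<And>i. i \<in> {1..m} \<Longrightarrow> convex_on UNIV (g i)"
    and "convex C"
    and "\<And>j. j \<in> {1..k} \<Longrightarrow> xs j \<in> dual_space"
    and "\<And>j. j \<in> {1..k} \<Longrightarrow> ys j \<in> dual_space"
    and "\<And>j z. j \<in> {1..k} \<Longrightarrow> h j z = pair_functional (xs j) (ys j) z - \<alpha> j"
    and "\<mu> = optimal_value \<phi> (feasible_map C m g k h)"
    and "M = solution_map \<phi> (feasible_map C m g k h)"
    and "xb \<in> eff_dom \<mu>" and "M xb \<noteq> {}"
    and "\<bar>\<phi> (x0, y0)\<bar> \<noteq> \<infinity>" and "isCont \<phi> (x0, y0)"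
    and "(x0, y0) \<in> interior C"
    and "\<And>i. i \<in> {1..m} \<Longrightarrow> g i (x0, y0) < 0"
    and "\<And>j. j \<in> {1..k} \<Longrightarrow> h j (x0, y0) = 0"
    and "yb \<in> M xb"
  shows "subdifferential \<mu> xb =
    (\<Union>(l, n)\<in>multipliers m g k (xb, yb).
       fst ` (subdifferential_pair (Lagrangian \<phi> C m g k h l n) (xb, yb)
              \<inter> dual_space \<times> {\<lambda>_. 0}))"
proof -
  let ?G = "feasible_map C m g k h"
  let ?L = "Lagrangian \<phi> C m g k h"
  define zb where "zb = (xb, yb)"
  have \<mu>zb: "\<mu> xb = \<phi> zb" and feas: "yb \<in> ?G xb"
    using assms(9,10,18) by (auto simp: solution_map_def zb_def)
  have gt: "\<phi> z > -\<infinity>" for z using assms(1) unfolding proper_fun_def by blast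
  obtain p where p: "\<phi> zb = ereal p"
    using gt[of zb] assms(11) \<mu>zb by (cases "\<phi> zb") (auto simp: eff_dom_def)
  have \<mu>le: "\<mu> x \<le> \<phi> (x, y)" if "y \<in> ?G x" for x y
    unfolding assms(9) optimal_value_def using that by (rule INF_lower)
  have zbC: "zb \<in> C" and hzb: "\<And>j. j \<in> {1..k} \<Longrightarrow> h j zb = 0"
    and gzb: "\<And>i. i \<in> {1..m} \<Longrightarrow> g i zb \<le> 0"
    using feas by (auto simp: feasible_map_def zb_def)
  have Lzb: "?L l n zb = \<phi> zb" if "(l, n) \<in> multipliers m g k zb" for l n
  proof -
    have "l i * g i zb = 0" if "i \<in> {1..m}" for i
      using that \<open>(l, n) \<in> _\<close> by (cases "g i zb = 0") (auto simp: multipliers_def active_set_def)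
    then have "(\<Sum>i=1..m. l i * g i zb) = 0" by (intro sum.neutral) blast
    moreover have "(\<Sum>j=1..k. n j * h j zb) = 0" by (intro sum.neutral) (simp add: hzb)
    ultimately show ?thesis using zbC by (simp add: Lagrangian_def indicator_fun_def)
  qed
  have weak_duality: "f \<in> subdifferential \<mu> xb"
    if ln: "(l, n) \<in> multipliers m g k zb"
      and f: "(f, \<lambda>_. 0) \<in> subdifferential_pair (?L l n) zb" for l n f
  proof -
    have fd: "f \<in> dual_space"
      and fL: "\<And>z. ereal (pair_functional f (\<lambda>_. 0) (z - zb)) \<le> ?L l n z - \<phi> zb"
      using f Lzb[OF ln] p by (auto simp: subdifferential_pair_def subdifferential_def)
    have "ereal (f (x - xb)) + \<phi> zb \<le> \<mu> x" for x
      unfolding assms(9) optimal_value_def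
    proof (rule INF_greatest)
      fix y assume y: "y \<in> ?G x"
      have "(\<Sum>i=1..m. l i * g i (x, y)) \<le> 0"
        using ln y by (intro sum_nonpos) (auto simp: multipliers_def feasible_map_def mult_nonneg_nonpos)
      moreover have "(\<Sum>j=1..k. n j * h j (x, y)) = 0"
        using y by (intro sum.neutral) (auto simp: feasible_map_def)
      ultimately have "?L l n (x, y) \<le> \<phi> (x, y)"
        using y by (cases "\<phi> (x, y)") (auto simp: Lagrangian_def indicator_fun_def feasible_map_def)
      moreover have "ereal (f (x - xb)) \<le> ?L l n (x, y) - \<phi> zb"
        using fL[of "(x, y)"] by (simp add: pair_functional_def zb_def)
      ultimately show "ereal (f (x - xb)) + \<phi> zb \<le> \<phi> (x, y)"
        unfolding p by (cases "\<phi> (x, y)"; cases "?L l n (x, y)") auto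
    qed
    then have bound: "ereal (f (x - xb)) + ereal p \<le> \<mu> x" for x unfolding p .
    have "ereal (f (x - xb)) \<le> \<mu> x - \<mu> xb" for x
      using bound[of x] unfolding \<mu>zb p by (cases "\<mu> x") auto
    then show ?thesis using fd by (auto simp: subdifferential_def \<mu>zb p)
  qed
  have strong_duality: "\<exists>(l, n)\<in>multipliers m g k zb. (f, \<lambda>_. 0) \<in> subdifferential_pair (?L l n) zb"
    if f: "f \<in> subdifferential \<mu> xb" for f
  proof -
    have fd: "f \<in> dual_space" and f\<mu>: "\<And>x. ereal (f (x - xb)) \<le> \<mu> x - ereal p"
      using f by (auto simp: subdifferential_def \<mu>zb p)
    \<comment> \<open>The excess \<open>e\<close> of \<open>\<phi> - F\<close> over its value at \<open>zb\<close> is nonnegative at feasible points.\<close>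
    define F where "F = pair_functional f (\<lambda>_::'y. 0)"
    have F: "F \<in> dual_space" unfolding F_def by (rule pair_functional_zero_in_dual_space[OF fd])
    then have linF: "linear F" by (simp add: dual_space_def)
    define D where "D = C \<inter> eff_dom \<phi>"
    define q where "q z = real_of_ereal (\<phi> z)" for z
    define e where "e z = q z + (- F (z - zb) - p)" for z
    have q: "\<phi> z = ereal (q z)" if "z \<in> D" for z
      using gt[of z] that by (cases "\<phi> z") (auto simp: q_def D_def eff_dom_def)
    have q_conv: "convex_on (eff_dom \<phi>) q"
      unfolding q_def by (rule convex_fun_imp_convex_on_eff_dom[OF assms(1,2)])
    then have cD: "convex D"
      using assms(5) unfolding D_def by (intro convex_Int) (auto simp: convex_on_def)
    have haff: "h j (u *\<^sub>R z + v *\<^sub>R w) = u * h j z + v * h j w"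
      if j: "j \<in> {1..k}" and uv: "u + v = 1" for j u v z w
    proof -
      let ?H = "pair_functional (xs j) (ys j)"
      have "linear ?H" using assms(6,7)[OF j] by (intro linear_pair_functional) (auto simp: dual_space_def)
      then have "h j (u *\<^sub>R z + v *\<^sub>R w) = u * ?H z + v * ?H w - (u + v) * \<alpha> j"
        using uv by (simp add: assms(8)[OF j] linear_add linear_scale)
      then show ?thesis by (simp add: assms(8)[OF j] algebra_simps)
    qed
    have Faff: "- F (u *\<^sub>R z + v *\<^sub>R w - zb) - p = u * (- F (z - zb) - p) + v * (- F (w - zb) - p)"
      if "u + v = 1" for u v z w
    proof -
      have "F (u *\<^sub>R z + v *\<^sub>R w - zb) = u * F z + v * F w - (u + v) * F zb"
        using linF that by (simp add: linear_add linear_scale linear_diff)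
      moreover have "p = (u + v) * p" using that by simp
      ultimately show ?thesis using linF by (simp add: linear_diff algebra_simps)
    qed
    have "convex_on D (\<lambda>z. - F (z - zb) - p)"
      using cD by (auto simp: convex_on_def Faff)
    moreover have "convex_on D q" by (rule convex_on_subset[OF q_conv _ cD]) (auto simp: D_def)
    ultimately have e_conv: "convex_on D e"
      unfolding e_def by (intro convex_on_add)
    have ev: "\<forall>\<^sub>F w in nhds (x0, y0). w \<in> D"
    proof -
      have "\<forall>\<^sub>F w in nhds (x0, y0). \<phi> w < \<infinity>"
        using assms(13,14) unfolding isCont_def tendsto_at_iff_tendsto_nhds
        by (intro order_tendstoD(2)[of \<phi> "\<phi> (x0, y0)"]) auto
      moreover have "\<forall>\<^sub>F w in nhds (x0, y0). w \<in> C"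
        using assms(15) by (auto simp: eventually_nhds interior_def)
      ultimately show ?thesis by eventually_elim (simp add: D_def eff_dom_def)
    qed
    have e_nonneg: "0 \<le> e z"
      if "z \<in> D" "\<forall>i\<in>{1..m}. g i z \<le> 0" "\<forall>j\<in>{1..k}. h j z = 0" for z
    proof -
      obtain x y where z: "z = (x, y)" by (cases z)
      have "y \<in> ?G x" using that by (simp add: feasible_map_def z D_def)
      then have "\<mu> x \<le> ereal (q z)" using \<mu>le q[OF that(1)] by (metis z)
      then have "ereal (f (x - xb)) \<le> ereal (q z) - ereal p"
        using f\<mu>[of x] by (meson ereal_minus_mono order_refl order_trans)
      then show ?thesis by (simp add: e_def F_def z zb_def pair_functional_def)
    qed
    obtain l n where l: "\<And>i. i \<in> {1..m} \<Longrightarrow> l i \<ge> 0"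
      and ln: "\<And>z. z \<in> D \<Longrightarrow> 0 \<le> e z + (\<Sum>i=1..m. l i * g i z) + (\<Sum>j=1..k. n j * h j z)"
    proof (rule convex_program_multipliers[of "{1..m}" "{1..k}" D e g h "(x0, y0)"])
      show "convex_on D (g i)" if "i \<in> {1..m}" for i
        using assms(4)[OF that] cD by (auto intro: convex_on_subset)
      show "(x0, y0) \<in> D" using ev by (rule eventually_nhds_x_imp_x)
      show "\<exists>t>0. (1 + t) *\<^sub>R (x0, y0) + (- t) *\<^sub>R z \<in> D" for z
        by (rule eventually_beyond_interior_point[OF ev])
    qed (use e_conv haff e_nonneg assms(16,17) in auto)
    define l' where "l' = restrict l {1..m}"
    define n' where "n' = restrict n {1..k}"
    have sums: "(\<Sum>i=1..m. l' i * g i z) = (\<Sum>i=1..m. l i * g i z)"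
      "(\<Sum>j=1..k. n' j * h j z) = (\<Sum>j=1..k. n j * h j z)" for z
      by (auto simp: l'_def n'_def intro: sum.cong)
    have zbD: "zb \<in> D" using zbC p by (simp add: D_def eff_dom_def)
    \<comment> \<open>Complementary slackness: at the minimizer the nonpositive terms \<open>l i * g i zb\<close> have a
      nonnegative sum.\<close>
    have "e zb = 0" using linF p by (simp add: e_def q_def linear_0)
    moreover have "(\<Sum>j=1..k. n j * h j zb) = 0" by (intro sum.neutral) (simp add: hzb)
    ultimately have "(\<Sum>i=1..m. - (l i * g i zb)) \<le> 0" using ln[OF zbD] by (simp add: sum_negf)
    moreover have nn: "0 \<le> - (l i * g i zb)" if "i \<in> {1..m}" for i
      using l[OF that] gzb[OF that] by (simp add: mult_nonneg_nonpos)
    ultimately have "(\<Sum>i=1..m. - (l i * g i zb)) = 0"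
      by (intro antisym sum_nonneg) auto
    then have slack: "l i * g i zb = 0" if "i \<in> {1..m}" for i
      using that nn sum_nonneg_eq_0_iff[of "{1..m}" "\<lambda>i. - (l i * g i zb)"] by auto
    have mult: "(l', n') \<in> multipliers m g k zb"
    proof -
      have "\<forall>i\<in>{1..m} - active_set m g zb. l i = 0"
        using slack by (fastforce simp: active_set_def)
      then show ?thesis using l by (auto simp: multipliers_def l'_def n'_def)
    qed
    have "ereal (F (z - zb)) \<le> ?L l' n' z - ereal p" for z
    proof (cases "z \<in> D")
      case True
      have L: "?L l' n' z = ereal (q z + (\<Sum>i=1..m. l i * g i z) + (\<Sum>j=1..k. n j * h j z))"
        using True unfolding Lagrangian_def sums q[OF True] by (simp add: indicator_fun_def D_def)
      show ?thesis unfolding L using ln[OF True] by (simp add: e_def)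
    next
      case False
      then have "?L l' n' z = \<infinity>"
        using gt[of z] by (cases "\<phi> z") (auto simp: Lagrangian_def indicator_fun_def D_def eff_dom_def)
      then show ?thesis by simp
    qed
    then have "F \<in> subdifferential (?L l' n') zb"
      using F by (simp add: subdifferential_def Lzb[OF mult] p)
    then have "(f, \<lambda>_. 0) \<in> subdifferential_pair (?L l' n') zb"
      using fd by (simp add: subdifferential_pair_def F_def dual_space_def linear_zero)
    with mult show ?thesis by blast
  qed
  show ?thesis
    unfolding zb_def[symmetric]
  proof (intro equalityI subsetI)
    fix f assume "f \<in> subdifferential \<mu> xb"
    then obtain l n where ln: "(l, n) \<in> multipliers m g k zb"
      and f: "(f, \<lambda>_. 0) \<in> subdifferential_pair (?L l n) zb"
      using strong_duality by blast
    have "(f, \<lambda>_. 0) \<in> subdifferential_pair (?L l n) zb \<inter> dual_space \<times> {\<lambda>_. 0}"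
      using f by (simp add: subdifferential_pair_def)
    then have "f \<in> fst ` (subdifferential_pair (?L l n) zb \<inter> dual_space \<times> {\<lambda>_. 0})"
      by (rule rev_image_eqI) simp
    with ln show "f \<in> (\<Union>(l, n)\<in>multipliers m g k zb.
        fst ` (subdifferential_pair (?L l n) zb \<inter> dual_space \<times> {\<lambda>_. 0}))"
      by blast
  next
    fix f assume "f \<in> (\<Union>(l, n)\<in>multipliers m g k zb.
        fst ` (subdifferential_pair (?L l n) zb \<inter> dual_space \<times> {\<lambda>_. 0}))"
    then show "f \<in> subdifferential \<mu> xb"
      using weak_duality by auto
  qed
qed

end
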